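(* Let $(\mathcal A,\psi)$ be an algebra over a field $\Bbbk$, let $D:\mathcal A\to\mathcal A$ be a linear map and let $d$ be a derivation of $(\mathcal A,\psi)$ such that $[d,D]=dD-Dd=0$. If $D$ is a quasi-derivation (respectively, a near-derivation) of $(\mathcal A,\psi)$, then so is $D+d$.
   Context: An algebra $(\mathcal A,\psi)$ is a $\Bbbk$-vector space $\mathcal A$ (not necessarily finite-dimensional) with an arbitrary bilinear operation $\psi:\mathcal A\times\mathcal A\to\mathcal A$. For a linear map $D:\mathcal A\to\mathcal A$, the derived operation of $\psi$ with respect to $D$ is $$\psi'_D(x,y)=D(\psi(x,y))-\psi(Dx,y)-\psi(x,Dy),$$ and the second derived operation is $\psi''_D=(\psi'_D)'_D$. A derivation is a linear map $d$ with $\psi'_d=0$; a quasi-derivation is a linear map $D$ with $\psi''_D=0$; a near-derivation is a linear map $D$ such that $\psi''_D$ lies in the linear span $\langle\psi,\psi'_D\rangle$ in the space of bilinear operations on $\mathcal A$. *)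

theory Defs
  imports Complex_Main "HOL-Library.Function_Algebras"
begin

text \<open>The vector space is the whole type \<open>'a\<close>, with scalar multiplication \<open>scale\<close>.
  Neither associativity nor a unit is assumed, and the dimension is unrestricted.\<close>

locale bilinear_algebra = vector_space scale
  for scale :: "'k::field \<Rightarrow> 'a::ab_group_add \<Rightarrow> 'a" +
  fixes \<psi> :: "'a \<Rightarrow> 'a \<Rightarrow> 'a"
  assumes linear_right: "\<And>x. Vector_Spaces.linear scale scale (\<lambda>y. \<psi> x y)"
    and linear_left: "\<And>y. Vector_Spaces.linear scale scale (\<lambda>x. \<psi> x y)"

definition derived_op :: "('a::ab_group_add \<Rightarrow> 'a) \<Rightarrow> ('a \<Rightarrow> 'a \<Rightarrow> 'a) \<Rightarrow> 'a \<Rightarrow> 'a \<Rightarrow> 'a" where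
  "derived_op D \<psi> x y = D (\<psi> x y) - \<psi> (D x) y - \<psi> x (D y)"

definition op_scale :: "('k \<Rightarrow> 'a \<Rightarrow> 'a) \<Rightarrow> 'k \<Rightarrow> ('a \<Rightarrow> 'a \<Rightarrow> 'a) \<Rightarrow> 'a \<Rightarrow> 'a \<Rightarrow> 'a" where
  "op_scale scale c \<phi> = (\<lambda>x y. scale c (\<phi> x y))"

definition derivation ::
  "('k::field \<Rightarrow> 'a::ab_group_add \<Rightarrow> 'a) \<Rightarrow> ('a \<Rightarrow> 'a \<Rightarrow> 'a) \<Rightarrow> ('a \<Rightarrow> 'a) \<Rightarrow> bool" where
  "derivation scale \<psi> d \<longleftrightarrow>
     Vector_Spaces.linear scale scale d \<and> derived_op d \<psi> = (\<lambda>x y. 0)"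

definition quasi_derivation ::
  "('k::field \<Rightarrow> 'a::ab_group_add \<Rightarrow> 'a) \<Rightarrow> ('a \<Rightarrow> 'a \<Rightarrow> 'a) \<Rightarrow> ('a \<Rightarrow> 'a) \<Rightarrow> bool" where
  "quasi_derivation scale \<psi> D \<longleftrightarrow>
     Vector_Spaces.linear scale scale D \<and> derived_op D (derived_op D \<psi>) = (\<lambda>x y. 0)"

text \<open>The span below is taken in the space of all maps \<open>'a \<Rightarrow> 'a \<Rightarrow> 'a\<close> with pointwise
  operations. When \<open>\<psi>\<close> is bilinear and \<open>D\<close> is linear, both generators lie in the subspace of
  bilinear operations, so this is also their span there.\<close>

definition near_derivation ::
  "('k::field \<Rightarrow> 'a::ab_group_add \<Rightarrow> 'a) \<Rightarrow> ('a \<Rightarrow> 'a \<Rightarrow> 'a) \<Rightarrow> ('a \<Rightarrow> 'a) \<Rightarrow> bool" where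
  "near_derivation scale \<psi> D \<longleftrightarrow>
     Vector_Spaces.linear scale scale D \<and>
     derived_op D (derived_op D \<psi>) \<in> module.span (op_scale scale) {\<psi>, derived_op D \<psi>}"

lemma vector_space_op_scale:
  assumes "vector_space scale"
  shows "vector_space (op_scale scale)"
proof -
  interpret vector_space scale by fact
  show ?thesis
    by unfold_locales
      (simp_all add: op_scale_def fun_eq_iff scale_right_distrib scale_left_distrib)
qed

lemma near_derivation_iff:
  assumes "vector_space scale"
  shows "near_derivation scale \<psi> D \<longleftrightarrow>
    Vector_Spaces.linear scale scale D \<and>
    (\<exists>a b. \<forall>x y. derived_op D (derived_op D \<psi>) x y
      = scale a (\<psi> x y) + scale b (derived_op D \<psi> x y))"
proof -
  interpret op: vector_space "op_scale scale"
    using assms by (rule vector_space_op_scale)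
  have "f \<in> op.span {\<psi>, \<phi>} \<longleftrightarrow> (\<exists>a b. \<forall>x y. f x y = scale a (\<psi> x y) + scale b (\<phi> x y))"
    for f \<phi>
    unfolding op.span_insert[of \<psi>] op.span_singleton
    by (auto simp: op_scale_def fun_eq_iff algebra_simps image_iff)
  then show ?thesis
    by (simp add: near_derivation_def)
qed

end

theory Submission
  imports Defs
begin

text \<open>Write \<open>\<psi>'\<^sub>D\<close> for \<^const>\<open>derived_op\<close> applied to \<open>D\<close> and \<open>\<psi>\<close>. On biadditive operations this is
  the action of additive maps on operations: \<open>\<phi>'\<^sub>D\<close> is additive in \<open>D\<close> (\<open>derived_op_add\<close>), and maps
  that commute act by commuting operators (\<open>derived_op_commute\<close>). If \<open>\<psi>'\<^sub>d = 0\<close>, additivity gives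
  \<open>\<psi>'\<^bsub>D+d\<^esub> = \<psi>'\<^sub>D\<close>. If in addition \<open>d\<close> commutes with \<open>D\<close>, then \<open>(\<psi>'\<^sub>D)'\<^sub>d = (\<psi>'\<^sub>d)'\<^sub>D = 0\<close>, so \<open>d\<close> is
  also a derivation of \<open>\<psi>'\<^sub>D\<close>; hence \<open>(\<psi>'\<^sub>D)'\<^bsub>D+d\<^esub> = (\<psi>'\<^sub>D)'\<^sub>D\<close>. The first and second derived operations
  with respect to \<open>D + d\<close> and \<open>D\<close> therefore coincide, and any condition stated through them alone
  passes from \<open>D\<close> to \<open>D + d\<close>.\<close>

lemma linear_imp_additive:
  assumes "Vector_Spaces.linear scale scale' f"
  shows "additive f"
proof -
  interpret Vector_Spaces.linear scale scale' f by fact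
  show ?thesis by (simp add: additive_def add)
qed

lemma derived_op_add:
  assumes "\<And>y. additive (\<lambda>x. \<phi> x y)" and "\<And>x. additive (\<phi> x)"
  shows "derived_op (\<lambda>x. D x + d x) \<phi> = (\<lambda>x y. derived_op D \<phi> x y + derived_op d \<phi> x y)"
  by (simp add: derived_op_def fun_eq_iff additive.add[OF assms(1)] additive.add[OF assms(2)])

text \<open>Biadditivity has to survive one derivation step so that \<open>derived_op_add\<close> can be applied a
  second time, now to the derived operation.\<close>

lemma additive_derived_op_left:
  assumes "additive D" and "\<And>y. additive (\<lambda>x. \<phi> x y)"
  shows "additive (\<lambda>x. derived_op D \<phi> x y)"
  by (simp add: additive_def derived_op_def additive.add[OF assms(1)] additive.add[OF assms(2)])

lemma additive_derived_op_right:
  assumes "additive D" and "\<And>x. additive (\<phi> x)"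
  shows "additive (derived_op D \<phi> x)"
  by (simp add: additive_def derived_op_def additive.add[OF assms(1)] additive.add[OF assms(2)])

text \<open>After expansion, the nine terms of either side are obtained by letting \<open>d\<close> and \<open>D\<close> each act on
  the value, the left argument or the right argument of \<open>\<phi>\<close>. The order of the two maps matters
  only where both act in the same place, and there they commute by assumption.\<close>

lemma derived_op_commute:
  assumes "additive D" and "additive d" and "\<And>x. d (D x) = D (d x)"
  shows "derived_op d (derived_op D \<phi>) = derived_op D (derived_op d \<phi>)"
  by (simp add: derived_op_def fun_eq_iff additive.diff[OF assms(1)] additive.diff[OF assms(2)]
      assms(3))

lemma derived_op_zero:
  assumes "additive D"
  shows "derived_op D (\<lambda>x y. 0) = (\<lambda>x y. 0)"
  by (simp add: derived_op_def fun_eq_iff additive.zero[OF assms])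

theorem corollary3p4:
  fixes scale :: "'k::field \<Rightarrow> 'a::ab_group_add \<Rightarrow> 'a"
    and \<psi> :: "'a \<Rightarrow> 'a \<Rightarrow> 'a"
    and D d :: "'a \<Rightarrow> 'a"
  assumes "bilinear_algebra scale \<psi>"
    and "Vector_Spaces.linear scale scale D"
    and "derivation scale \<psi> d"
    and "(\<lambda>x. d (D x) - D (d x)) = (\<lambda>x. 0)"
  shows "(quasi_derivation scale \<psi> D \<longrightarrow> quasi_derivation scale \<psi> (\<lambda>x. D x + d x)) \<and>
         (near_derivation scale \<psi> D \<longrightarrow> near_derivation scale \<psi> (\<lambda>x. D x + d x))"
proof -
  interpret bilinear_algebra scale \<psi> by fact
  interpret vector_space_pair scale scale by unfold_locales
  have lin_d: "Vector_Spaces.linear scale scale d" and deriv: "derived_op d \<psi> = (\<lambda>x y. 0)"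
    using assms(3) by (simp_all add: derivation_def)
  have lin_sum: "Vector_Spaces.linear scale scale (\<lambda>x. D x + d x)"
    using assms(2) lin_d by (rule linear_compose_add)
  note D = linear_imp_additive[OF assms(2)]
  note d = linear_imp_additive[OF lin_d]
  have left: "additive (\<lambda>x. \<psi> x y)" and right: "additive (\<psi> x)" for x y
    using linear_imp_additive[OF linear_left] linear_imp_additive[OF linear_right] by simp_all
  have comm: "d (D x) = D (d x)" for x
    using fun_cong[OF assms(4), of x] by simp
  have first: "derived_op (\<lambda>x. D x + d x) \<psi> = derived_op D \<psi>"
    by (simp add: derived_op_add[OF left right] deriv)
  have "derived_op d (derived_op D \<psi>) = (\<lambda>x y. 0)"
    by (simp add: derived_op_commute[OF D d comm] deriv derived_op_zero[OF D])
  then have second: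
    "derived_op (\<lambda>x. D x + d x) (derived_op D \<psi>) = derived_op D (derived_op D \<psi>)"
    by (simp add: derived_op_add[OF additive_derived_op_left[OF D left]
          additive_derived_op_right[OF D right]])
  show ?thesis
    by (simp add: quasi_derivation_def near_derivation_def lin_sum first second)
qed

end
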